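(* Let $n\geq 1$ and let $\mathcal{H}=\{z_1=0,\ z_2=0,\ \ldots,\ z_n=0\}$ be the arrangement of the $n$ coordinate hyperplanes of $\mathbb{C}^n$, where $z_1,\ldots,z_n$ are the standard coordinates. Then the complement $\mathbb{C}^n\setminus\bigcup_{H\in\mathcal{H}}H$ of the union of its hyperplanes can be endowed with a structure of an almost-Frobenius manifold.
   Context: An almost-Frobenius structure on a complex manifold $M$ consists of a non-degenerate symmetric holomorphic bilinear form $g$ on the holomorphic tangent bundle of $M$, with flat Levi-Civita connection $\nabla$, together with an $\mathcal{O}_M$-bilinear, commutative and associative product $X\cdot Y$ on holomorphic vector fields, such that: (1) $g(X\cdot Y,Z)=g(X,Y\cdot Z)$ for all local holomorphic vector fields $X,Y,Z$; (2) for every $\lambda\in\mathbb{C}$ the connection $\nabla^\lambda_X Y=\nabla_XY+\lambda\, X\cdot Y$ is flat; (3) locally there is a holomorphic potential function $\Phi$, i.e. a function with $XYZ\,\Phi=g(X\cdot Y,Z)$ for all local $\nabla$-flat vector fields $X,Y,Z$; (4) the product has an identity element, a global holomorphic vector field $E$ (the Euler field), which is not required to be flat for $\nabla$, and both tensors are homogeneous with respect to $E$: $\mathcal{L}_E g=2g$, and the Lie derivative along $E$ of the product tensor is a constant multiple of the product tensor. *)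

theory Defs
  imports "HOL-Analysis.Analysis"
begin

text \<open>
  Complex differential geometry on an open subset \<open>M\<close> of \<open>\<complex>\<^sup>n\<close>, the latter being the type
  \<^typ>\<open>complex ^ 'n\<close>.  Through the global coordinates every holomorphic tangent space is
  identified with \<^typ>\<open>complex ^ 'n\<close>.  Functions and vector fields are total HOL functions; what
  they do outside the open set under consideration is irrelevant.
\<close>

type_synonym 'n vfield = "complex ^ 'n \<Rightarrow> complex ^ 'n"
type_synonym 'n form = "complex ^ 'n \<Rightarrow> complex ^ 'n \<Rightarrow> complex ^ 'n \<Rightarrow> complex"
type_synonym 'n product = "complex ^ 'n \<Rightarrow> complex ^ 'n \<Rightarrow> complex ^ 'n \<Rightarrow> complex ^ 'n"
type_synonym 'n connection = "'n vfield \<Rightarrow> 'n vfield \<Rightarrow> 'n vfield"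

text \<open>Holomorphic in several variables: the Frechet derivative exists and is complex linear.\<close>

definition holo_fun_on :: "(complex ^ 'n) set \<Rightarrow> (complex ^ 'n \<Rightarrow> complex) \<Rightarrow> bool" where
  "holo_fun_on U f \<longleftrightarrow>
     (\<forall>p\<in>U. \<exists>D. (f has_derivative D) (at p) \<and> Vector_Spaces.linear (*s) (*) D)"

definition holo_vfield_on :: "(complex ^ 'n) set \<Rightarrow> 'n vfield \<Rightarrow> bool" where
  "holo_vfield_on U X \<longleftrightarrow> (\<forall>i. holo_fun_on U (\<lambda>p. X p $ i))"

definition vderiv :: "'n::finite vfield \<Rightarrow> (complex ^ 'n \<Rightarrow> complex) \<Rightarrow> complex ^ 'n \<Rightarrow> complex" where
  "vderiv X f = (\<lambda>p. frechet_derivative f (at p) (X p))"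

definition bracket :: "'n::finite vfield \<Rightarrow> 'n vfield \<Rightarrow> 'n vfield" where
  "bracket X Y = (\<lambda>p. \<chi> i. vderiv X (\<lambda>q. Y q $ i) p - vderiv Y (\<lambda>q. X q $ i) p)"

definition app_form :: "'n::finite form \<Rightarrow> 'n vfield \<Rightarrow> 'n vfield \<Rightarrow> complex ^ 'n \<Rightarrow> complex" where
  "app_form g X Y = (\<lambda>p. g p (X p) (Y p))"

definition app_product :: "'n::finite product \<Rightarrow> 'n vfield \<Rightarrow> 'n vfield \<Rightarrow> 'n vfield" where
  "app_product m X Y = (\<lambda>p. m p (X p) (Y p))"

definition holo_metric_on :: "(complex ^ 'n) set \<Rightarrow> 'n form \<Rightarrow> bool" where
  "holo_metric_on M g \<longleftrightarrow>
     (\<forall>v w. holo_fun_on M (\<lambda>p. g p v w)) \<and>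
     (\<forall>p\<in>M.
        (\<forall>v. Vector_Spaces.linear (*s) (*) (\<lambda>w. g p v w)) \<and>
        (\<forall>w. Vector_Spaces.linear (*s) (*) (\<lambda>v. g p v w)) \<and>
        (\<forall>v w. g p v w = g p w v) \<and>
        (\<forall>v. (\<forall>w. g p v w = 0) \<longrightarrow> v = 0))"

text \<open>
  An \<open>\<O>\<^sub>M\<close>-bilinear product on holomorphic vector fields is a holomorphic family of complex
  bilinear products on the tangent spaces.
\<close>

definition holo_product_on :: "(complex ^ 'n) set \<Rightarrow> 'n product \<Rightarrow> bool" where
  "holo_product_on M m \<longleftrightarrow>
     (\<forall>v w. holo_vfield_on M (\<lambda>p. m p v w)) \<and>
     (\<forall>p\<in>M.
        (\<forall>v. Vector_Spaces.linear (*s) (*s) (\<lambda>w. m p v w)) \<and>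
        (\<forall>w. Vector_Spaces.linear (*s) (*s) (\<lambda>v. m p v w)) \<and>
        (\<forall>v w. m p v w = m p w v) \<and>
        (\<forall>u v w. m p (m p u v) w = m p u (m p v w)))"

text \<open>
  A holomorphic connection on the tangent bundle.  A single operator serves all open subsets
  \<open>U\<close> of \<open>M\<close>; the second clause makes it local, i.e. a map of sheaves.
\<close>

definition holo_connection_on :: "(complex ^ 'n) set \<Rightarrow> 'n connection \<Rightarrow> bool" where
  "holo_connection_on M nabla \<longleftrightarrow> (\<forall>U. open U \<and> U \<subseteq> M \<longrightarrow>
     (\<forall>X Y. holo_vfield_on U X \<and> holo_vfield_on U Y \<longrightarrow> holo_vfield_on U (nabla X Y)) \<and>
     (\<forall>X X' Y Y'. holo_vfield_on U X \<and> holo_vfield_on U Y \<and>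
        (\<forall>p\<in>U. X' p = X p \<and> Y' p = Y p) \<longrightarrow> (\<forall>p\<in>U. nabla X' Y' p = nabla X Y p)) \<and>
     (\<forall>X X' Y. holo_vfield_on U X \<and> holo_vfield_on U X' \<and> holo_vfield_on U Y \<longrightarrow>
        (\<forall>p\<in>U. nabla (\<lambda>q. X q + X' q) Y p = nabla X Y p + nabla X' Y p)) \<and>
     (\<forall>f X Y. holo_fun_on U f \<and> holo_vfield_on U X \<and> holo_vfield_on U Y \<longrightarrow>
        (\<forall>p\<in>U. nabla (\<lambda>q. f q *s X q) Y p = f p *s nabla X Y p)) \<and>
     (\<forall>X Y Y'. holo_vfield_on U X \<and> holo_vfield_on U Y \<and> holo_vfield_on U Y' \<longrightarrow>
        (\<forall>p\<in>U. nabla X (\<lambda>q. Y q + Y' q) p = nabla X Y p + nabla X Y' p)) \<and>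
     (\<forall>f X Y. holo_fun_on U f \<and> holo_vfield_on U X \<and> holo_vfield_on U Y \<longrightarrow>
        (\<forall>p\<in>U. nabla X (\<lambda>q. f q *s Y q) p = vderiv X f p *s Y p + f p *s nabla X Y p)))"

definition levi_civita_on :: "(complex ^ 'n) set \<Rightarrow> 'n form \<Rightarrow> 'n connection \<Rightarrow> bool" where
  "levi_civita_on M g nabla \<longleftrightarrow> holo_connection_on M nabla \<and>
     (\<forall>U. open U \<and> U \<subseteq> M \<longrightarrow>
       (\<forall>X Y. holo_vfield_on U X \<and> holo_vfield_on U Y \<longrightarrow>
          (\<forall>p\<in>U. nabla X Y p - nabla Y X p = bracket X Y p)) \<and>
       (\<forall>X Y Z. holo_vfield_on U X \<and> holo_vfield_on U Y \<and> holo_vfield_on U Z \<longrightarrow>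
          (\<forall>p\<in>U. vderiv X (app_form g Y Z) p =
             app_form g (nabla X Y) Z p + app_form g Y (nabla X Z) p)))"

definition curvature :: "'n::finite connection \<Rightarrow> 'n vfield \<Rightarrow> 'n vfield \<Rightarrow> 'n vfield \<Rightarrow> 'n vfield" where
  "curvature nabla X Y Z = (\<lambda>p.
     nabla X (nabla Y Z) p - nabla Y (nabla X Z) p - nabla (bracket X Y) Z p)"

definition flat_connection_on :: "(complex ^ 'n) set \<Rightarrow> 'n connection \<Rightarrow> bool" where
  "flat_connection_on M nabla \<longleftrightarrow> (\<forall>U X Y Z. open U \<and> U \<subseteq> M \<and>
     holo_vfield_on U X \<and> holo_vfield_on U Y \<and> holo_vfield_on U Z \<longrightarrow>
     (\<forall>p\<in>U. curvature nabla X Y Z p = 0))"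

definition flat_vfield_on :: "(complex ^ 'n) set \<Rightarrow> 'n connection \<Rightarrow> 'n vfield \<Rightarrow> bool" where
  "flat_vfield_on U nabla X \<longleftrightarrow> holo_vfield_on U X \<and>
     (\<forall>W. holo_vfield_on U W \<longrightarrow> (\<forall>p\<in>U. nabla W X p = 0))"

definition deformed_connection :: "'n::finite connection \<Rightarrow> 'n product \<Rightarrow> complex \<Rightarrow> 'n connection" where
  "deformed_connection nabla m l = (\<lambda>X Y p. nabla X Y p + l *s app_product m X Y p)"

definition lie_form :: "'n::finite vfield \<Rightarrow> 'n form \<Rightarrow> 'n vfield \<Rightarrow> 'n vfield \<Rightarrow> complex ^ 'n \<Rightarrow> complex"
  where
  "lie_form E g X Y = (\<lambda>p. vderiv E (app_form g X Y) p
     - app_form g (bracket E X) Y p - app_form g X (bracket E Y) p)"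

definition lie_product :: "'n::finite vfield \<Rightarrow> 'n product \<Rightarrow> 'n vfield \<Rightarrow> 'n vfield \<Rightarrow> 'n vfield" where
  "lie_product E m X Y = (\<lambda>p. bracket E (app_product m X Y) p
     - app_product m (bracket E X) Y p - app_product m X (bracket E Y) p)"

text \<open>
  The connection is determined by \<open>g\<close> (as far as local holomorphic vector fields are concerned);
  it is a parameter only so that it can be referred to.
\<close>

locale almost_frobenius_structure =
  fixes M :: "(complex ^ 'n) set"
    and g :: "'n form"
    and nabla :: "'n connection"
    and m :: "'n product"
    and E :: "'n vfield"
  assumes open_M: "open M"
    and metric: "holo_metric_on M g"
    and levi_civita: "levi_civita_on M g nabla"
    and flat: "flat_connection_on M nabla"
    and product: "holo_product_on M m"
    and invariant: "\<And>U X Y Z p. open U \<Longrightarrow> U \<subseteq> M \<Longrightarrow>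
          holo_vfield_on U X \<Longrightarrow> holo_vfield_on U Y \<Longrightarrow> holo_vfield_on U Z \<Longrightarrow> p \<in> U \<Longrightarrow>
          app_form g (app_product m X Y) Z p = app_form g X (app_product m Y Z) p"
    and deformed_flat: "\<And>l. flat_connection_on M (deformed_connection nabla m l)"
    and potential: "\<And>p. p \<in> M \<Longrightarrow>
          \<exists>U \<Phi>. open U \<and> p \<in> U \<and> U \<subseteq> M \<and> holo_fun_on U \<Phi> \<and>
            (\<forall>V X Y Z. open V \<and> V \<subseteq> U \<and> flat_vfield_on V nabla X \<and>
               flat_vfield_on V nabla Y \<and> flat_vfield_on V nabla Z \<longrightarrow>
               (\<forall>q\<in>V. vderiv X (vderiv Y (vderiv Z \<Phi>)) q = app_form g (app_product m X Y) Z q))"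
    and Euler_holo: "holo_vfield_on M E"
    and Euler_unit: "\<And>p v. p \<in> M \<Longrightarrow> m p (E p) v = v"
    and Euler_metric: "\<And>U X Y p. open U \<Longrightarrow> U \<subseteq> M \<Longrightarrow>
          holo_vfield_on U X \<Longrightarrow> holo_vfield_on U Y \<Longrightarrow> p \<in> U \<Longrightarrow>
          lie_form E g X Y p = 2 * app_form g X Y p"
    and Euler_product: "\<exists>c. \<forall>U X Y. open U \<and> U \<subseteq> M \<and>
          holo_vfield_on U X \<and> holo_vfield_on U Y \<longrightarrow>
          (\<forall>p\<in>U. lie_product E m X Y p = c *s app_product m X Y p)"

definition coordinate_arrangement :: "(complex ^ 'n) set set" where
  "coordinate_arrangement = range (\<lambda>i. {z. z $ i = 0})"

end

theory Submission
  imports Defs "HOL-Complex_Analysis.Cauchy_Integral_Formula"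
begin

text \<open>
  The structure is written down explicitly in the standard coordinates, as a product of \<open>n\<close> copies
  of a one-dimensional one: the metric is \<open>\<Sum>\<^sub>i dz\<^sub>i\<^sup>2\<close>, so the Levi-Civita connection
  differentiates components, the product is \<open>\<partial>\<^sub>i \<cdot> \<partial>\<^sub>j = \<delta>\<^sub>i\<^sub>j \<partial>\<^sub>i / z\<^sub>i\<close>, and the
  Euler field is the radial field \<open>E = \<Sum>\<^sub>i z\<^sub>i \<partial>\<^sub>i\<close>, which is visibly the identity.

  For this metric the choice is forced among diagonal products: a product \<open>\<partial>\<^sub>i \<cdot> \<partial>\<^sub>i = h\<^sub>i(z\<^sub>i) \<partial>\<^sub>i\<close> has
  identity \<open>\<Sum>\<^sub>i h\<^sub>i\<^sup>-\<^sup>1 \<partial>\<^sub>i\<close>, and for this to scale the metric with weight 2, \<open>h\<^sub>i\<close> must be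
  \<open>1 / z\<^sub>i\<close> up to a translation.  Its poles are the coordinate hyperplanes.  A potential is a sum
  of third primitives of \<open>1 / z\<^sub>i\<close>, namely \<open>\<Sum>\<^sub>i z\<^sub>i\<^sup>2 / 2 log z\<^sub>i\<close>
  (lemma \<open>potential_log_product\<close>).  The deformed connections are direct sums of line bundles twisted
  by the closed forms \<open>l dz\<^sub>i / z\<^sub>i\<close> and hence flat (lemma
  \<open>flat_deformed_coordinate_connection\<close>); \<open>l = 0\<close> is the flatness of the Levi-Civita connection.

  Besides these computations, the proof needs that derivatives of a holomorphic function along
  holomorphic fields are again holomorphic, and that second derivatives are symmetric, where
  holomorphic means only complex differentiable.  This is lemma \<open>holo_fun_on_frechet_derivative\<close>,
  which is reduced to the one-variable Cauchy inequality on complex lines.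
\<close>

section \<open>Holomorphic functions of several variables\<close>

lemma complex_linear_iff:
  fixes D :: "complex ^ 'n::finite \<Rightarrow> complex"
  shows "Vector_Spaces.linear (*s) (*) D \<longleftrightarrow>
     (\<forall>x y. D (x + y) = D x + D y) \<and> (\<forall>c x. D (c *s x) = c * D x)"
  by (simp add: Vector_Spaces.linear_iff vec.vector_space_axioms
      vector_space_over_itself.vector_space_axioms)

lemma norm_vector_scalar_mult:
  fixes v :: "complex ^ 'n::finite"
  shows "norm (c *s v) = norm c * norm v"
  by (simp add: norm_vec_def norm_mult L2_set_right_distrib)

lemma bounded_linear_complex_line:
  fixes v :: "complex ^ 'n::finite"
  shows "bounded_linear (\<lambda>t. t *s v)"
  by (rule bounded_linear_intro[where K = "norm v"])
     (simp_all add: norm_vector_scalar_mult vec_eq_iff algebra_simps)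

lemma holo_fun_onD:
  fixes f :: "complex ^ 'n::finite \<Rightarrow> complex"
  assumes "holo_fun_on U f" "p \<in> U"
  shows holo_fun_on_has_derivative: "(f has_derivative frechet_derivative f (at p)) (at p)"
    and holo_fun_on_linear: "Vector_Spaces.linear (*s) (*) (frechet_derivative f (at p))"
proof -
  obtain D where "(f has_derivative D) (at p)" "Vector_Spaces.linear (*s) (*) D"
    using assms unfolding holo_fun_on_def by blast
  moreover from this have "D = frechet_derivative f (at p)"
    by (rule_tac frechet_derivative_at)
  ultimately show "(f has_derivative frechet_derivative f (at p)) (at p)"
    and "Vector_Spaces.linear (*s) (*) (frechet_derivative f (at p))" by auto
qed

lemma frechet_derivative_scale:
  fixes f :: "complex ^ 'n::finite \<Rightarrow> complex"
  assumes "holo_fun_on U f" "p \<in> U"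
  shows "frechet_derivative f (at p) (c *s v) = c * frechet_derivative f (at p) v"
  using holo_fun_on_linear[OF assms] by (simp add: complex_linear_iff)

lemma holo_fun_on_continuous:
  fixes f :: "complex ^ 'n::finite \<Rightarrow> complex"
  assumes "holo_fun_on U f"
  shows "continuous_on U f"
  using assms holo_fun_on_has_derivative has_derivative_continuous
  by (metis continuous_at_imp_continuous_on)

lemma holo_fun_on_line:
  fixes f :: "complex ^ 'n::finite \<Rightarrow> complex"
  assumes "holo_fun_on U f" "p + t *s v \<in> U"
  shows "((\<lambda>s. f (p + s *s v)) has_field_derivative
           frechet_derivative f (at (p + t *s v)) v) (at t)"
proof -
  have "((\<lambda>s. p + s *s v) has_derivative (\<lambda>s. s *s v)) (at t)"
    using bounded_linear_imp_has_derivative[OF bounded_linear_complex_line]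
    by (auto intro!: derivative_eq_intros)
  from has_derivative_compose[OF this holo_fun_on_has_derivative[OF assms]]
  have "((\<lambda>s. f (p + s *s v)) has_derivative
          (\<lambda>s. frechet_derivative f (at (p + t *s v)) (s *s v))) (at t)" .
  then show ?thesis
    unfolding has_field_derivative_def frechet_derivative_scale[OF assms]
    by (simp only: mult.commute[of _ "frechet_derivative f _ v"])
qed

text \<open>
  This is the one-variable Cauchy inequality for \<open>t \<mapsto> f (p + t v)\<close> on the disc of radius
  \<open>r / \<parallel>v\<parallel>\<close>, whose image stays in the ball.  It turns uniform closeness of functions into
  uniform closeness of their derivatives.
\<close>

lemma Cauchy_estimate_several_variables:
  fixes f :: "complex ^ 'n::finite \<Rightarrow> complex"
  assumes hf: "holo_fun_on U f" and sub: "cball p r \<subseteq> U" and r: "0 < r"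
    and B: "\<And>q. q \<in> cball p r \<Longrightarrow> norm (f q) \<le> B"
  shows "norm (frechet_derivative f (at p) v) \<le> B / r * norm v"
proof (cases "v = 0")
  case True
  have "frechet_derivative f (at p) 0 = 0"
    using holo_fun_on_has_derivative[OF hf, of p] sub r
    by (metis centre_in_cball has_derivative_linear linear_0 less_imp_le subsetD)
  then show ?thesis using True by simp
next
  case False
  define \<rho> where "\<rho> = r / norm v"
  have \<rho>: "\<rho> > 0" using False r by (simp add: \<rho>_def)
  have inc: "p + t *s v \<in> cball p r" if "norm t \<le> \<rho>" for t
    using that False by (simp add: dist_norm norm_vector_scalar_mult \<rho>_def field_simps)
  have der: "((\<lambda>s. f (p + s *s v)) has_field_derivative
           frechet_derivative f (at (p + t *s v)) v) (at t)" if "norm t \<le> \<rho>" for t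
    using holo_fun_on_line[OF hf, of p t v] inc[OF that] sub by blast
  have "norm ((deriv ^^ 1) (\<lambda>s. f (p + s *s v)) 0) \<le> fact 1 * B / \<rho> ^ 1"
  proof (rule Cauchy_inequality[OF _ _ \<rho>])
    show "(\<lambda>s. f (p + s *s v)) holomorphic_on ball 0 \<rho>"
      unfolding holomorphic_on_open[OF open_ball] using der by (meson less_imp_le mem_ball_0)
    show "continuous_on (cball 0 \<rho>) (\<lambda>s. f (p + s *s v))"
      using der by (meson DERIV_isCont continuous_at_imp_continuous_on mem_cball_0)
    show "norm (f (p + x *s v)) \<le> B" if "norm (0 - x) = \<rho>" for x
      using B[OF inc] that by simp
  qed
  also have "(deriv ^^ 1) (\<lambda>s. f (p + s *s v)) 0 = frechet_derivative f (at p) v"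
    using DERIV_imp_deriv[OF der[of 0]] \<rho> by simp
  finally show ?thesis by (simp add: \<rho>_def)
qed

lemma holo_fun_onI:
  fixes f :: "complex ^ 'n::finite \<Rightarrow> complex"
  assumes "\<And>p. p \<in> U \<Longrightarrow> (f has_derivative D p) (at p)"
    and "\<And>p c v. p \<in> U \<Longrightarrow> D p (c *s v) = c * D p v"
  shows "holo_fun_on U f"
  unfolding holo_fun_on_def complex_linear_iff
  using assms by (meson has_derivative_linear linear_add)

lemma holo_fun_on_diff:
  fixes f :: "complex ^ 'n::finite \<Rightarrow> complex"
  assumes "holo_fun_on U f" "holo_fun_on U g"
  shows "holo_fun_on U (\<lambda>p. f p - g p)"
  by (rule holo_fun_onI[OF has_derivative_diff[OF assms[THEN holo_fun_on_has_derivative]]])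
     (simp_all add: frechet_derivative_scale[OF assms(1)] frechet_derivative_scale[OF assms(2)]
       algebra_simps)

text \<open>
  The Weierstrass theorem in several variables.  Applied to the differences \<open>F k - F l\<close>, Cauchy's
  estimate shows that the derivatives are uniformly Cauchy on a smaller ball; then limit and
  derivative may be exchanged.
\<close>

lemma holo_fun_on_uniform_limit:
  fixes F :: "nat \<Rightarrow> complex ^ 'n::finite \<Rightarrow> complex"
  assumes U: "open U" and hF: "\<And>k. holo_fun_on U (F k)"
    and lim: "uniform_limit U F f sequentially"
  shows "holo_fun_on U f"
    and "p \<in> U \<Longrightarrow> (\<lambda>k. frechet_derivative (F k) (at p) v) \<longlonglongrightarrow> frechet_derivative f (at p) v"
proof -
  have *: "\<exists>D. (f has_derivative D) (at p) \<and> (\<forall>c v. D (c *s v) = c * D v) \<and>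
     (\<forall>v. (\<lambda>k. frechet_derivative (F k) (at p) v) \<longlonglongrightarrow> D v)" if "p \<in> U" for p
  proof -
    obtain R where R: "R > 0" "cball p R \<subseteq> U"
      using U \<open>p \<in> U\<close> by (meson open_contains_cball_eq)
    define r where "r = R / 2"
    have r: "r > 0" using R by (simp add: r_def)
    have sub: "cball q r \<subseteq> U" if "q \<in> ball p r" for q
    proof -
      have "cball q r \<subseteq> cball p R"
        using that by (intro cball_subset_cball_iff[THEN iffD2] disjI1) (simp add: r_def dist_commute)
      then show ?thesis using R by blast
    qed
    define D where "D k q = frechet_derivative (F k) (at q)" for k q
    have derD: "(F k has_derivative D k q) (at q)" if "q \<in> ball p r" for k q
      unfolding D_def using holo_fun_on_has_derivative[OF hF] sub[OF that] r
      by (metis centre_in_cball less_imp_le subsetD)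
    have unifC: "\<exists>N. \<forall>k\<ge>N. \<forall>l\<ge>N. \<forall>q\<in>ball p r. \<forall>h. norm (D k q h - D l q h) \<le> e * norm h"
      if e: "e > 0" for e
    proof -
      have "uniformly_Cauchy_on U F"
        using lim by (meson uniformly_convergent_Cauchy uniformly_convergent_on_def)
      then obtain N where N: "\<And>k l q. k \<ge> N \<Longrightarrow> l \<ge> N \<Longrightarrow> q \<in> U \<Longrightarrow> dist (F k q) (F l q) < e * r"
        using e r unfolding uniformly_Cauchy_on_def by (metis mult_pos_pos)
      have "norm (D k q h - D l q h) \<le> e * norm h"
        if "k \<ge> N" "l \<ge> N" "q \<in> ball p r" for k l q h
      proof -
        have "norm (frechet_derivative (\<lambda>x. F k x - F l x) (at q) h) \<le> (e * r) / r * norm h"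
          using sub[OF that(3)]
          by (intro Cauchy_estimate_several_variables[OF holo_fun_on_diff[OF hF hF] _ r])
             (auto simp flip: dist_norm intro!: less_imp_le N that)
        moreover have "frechet_derivative (\<lambda>x. F k x - F l x) (at q) = (\<lambda>h. D k q h - D l q h)"
          using has_derivative_diff[OF derD derD] that(3) by (metis frechet_derivative_at)
        ultimately show ?thesis using r by simp
      qed
      then show ?thesis by blast
    qed
    define D' where "D' q h = lim (\<lambda>k. D k q h)" for q h
    have limD: "(\<lambda>k. D k q h) \<longlonglongrightarrow> D' q h" if q: "q \<in> ball p r" for q h
    proof -
      have "Cauchy (\<lambda>k. D k q h)"
      proof (rule CauchyI)
        fix e :: real assume e: "e > 0"
        define e' where "e' = e / (norm h + 1)"
        have "e' > 0" using e by (simp add: e'_def add_nonneg_pos)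
        then obtain N where N: "\<And>k l. k \<ge> N \<Longrightarrow> l \<ge> N \<Longrightarrow> norm (D k q h - D l q h) \<le> e' * norm h"
          using unifC q by metis
        have "e' * norm h < e' * (norm h + 1)"
          using \<open>e' > 0\<close> by (simp add: algebra_simps)
        also have "\<dots> = e"
          using norm_ge_zero[of h] by (simp add: e'_def add_nonneg_eq_0_iff)
        finally have "e' * norm h < e" .
        then show "\<exists>M. \<forall>m\<ge>M. \<forall>n\<ge>M. norm (D m q h - D n q h) < e"
          using N by (meson le_less_trans)
      qed
      then show ?thesis
        unfolding D'_def by (simp add: Cauchy_convergent_iff convergent_LIMSEQ_iff)
    qed
    have "\<exists>g. \<forall>x\<in>ball p r. (\<lambda>n. F n x) \<longlonglongrightarrow> g x \<and> (g has_derivative D' x) (at x within ball p r)"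
    proof (rule has_derivative_sequence)
      show "convex (ball p r)" by simp
      show "(F n has_derivative D n x) (at x within ball p r)" if "x \<in> ball p r" for n x
        using derD that has_derivative_at_withinI by blast
      show "p \<in> ball p r" using r by simp
      show "(\<lambda>n. F n p) \<longlonglongrightarrow> f p"
        using tendsto_uniform_limitI[OF lim \<open>p \<in> U\<close>] .
      show "\<forall>\<^sub>F n in sequentially. \<forall>x\<in>ball p r. \<forall>h. norm (D n x h - D' x h) \<le> e * norm h"
        if "e > 0" for e
      proof -
        obtain N where N: "\<And>k l q h. k \<ge> N \<Longrightarrow> l \<ge> N \<Longrightarrow> q \<in> ball p r \<Longrightarrow>
            norm (D k q h - D l q h) \<le> e * norm h"
          using unifC[OF \<open>e > 0\<close>] by blast
        have "norm (D k q h - D' q h) \<le> e * norm h" if "k \<ge> N" "q \<in> ball p r" for k q h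
        proof (rule tendsto_upperbound)
          show "(\<lambda>l. norm (D k q h - D l q h)) \<longlonglongrightarrow> norm (D k q h - D' q h)"
            by (intro tendsto_intros limD that)
          show "\<forall>\<^sub>F l in sequentially. norm (D k q h - D l q h) \<le> e * norm h"
            using N that eventually_sequentially by blast
        qed simp
        then show ?thesis using eventually_sequentially by blast
      qed
    qed
    then obtain g where g: "\<And>x. x \<in> ball p r \<Longrightarrow> (\<lambda>n. F n x) \<longlonglongrightarrow> g x"
      "(g has_derivative D' p) (at p within ball p r)"
      using r by (metis centre_in_ball)
    have "g x = f x" if "x \<in> ball p r" for x
      using g(1)[OF that] tendsto_uniform_limitI[OF lim] sub[OF that] r LIMSEQ_unique
      by (metis centre_in_cball less_imp_le subsetD)
    with g(2) have "(f has_derivative D' p) (at p within ball p r)"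
      using r by (metis (no_types, lifting) centre_in_ball has_derivative_transform)
    then have "(f has_derivative D' p) (at p)"
      using r by (simp add: at_within_open[where S = "ball p r"])
    moreover have "D' p (c *s v) = c * D' p v" for c v
    proof (rule LIMSEQ_unique)
      show "(\<lambda>k. D k p (c *s v)) \<longlonglongrightarrow> D' p (c *s v)" using limD r by simp
      have "D k p (c *s v) = c * D k p v" for k
        by (simp add: D_def frechet_derivative_scale[OF hF \<open>p \<in> U\<close>])
      then show "(\<lambda>k. D k p (c *s v)) \<longlonglongrightarrow> c * D' p v"
        using tendsto_mult_left[OF limD] r by simp
    qed
    ultimately show ?thesis
      using limD r unfolding D_def by auto
  qed
  then obtain D where D: "\<And>p. p \<in> U \<Longrightarrow> (f has_derivative D p) (at p)"
      "\<And>p c v. p \<in> U \<Longrightarrow> D p (c *s v) = c * D p v"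
      "\<And>p v. p \<in> U \<Longrightarrow> (\<lambda>k. frechet_derivative (F k) (at p) v) \<longlonglongrightarrow> D p v"
    by metis
  show "holo_fun_on U f" using D holo_fun_onI by blast
  show "(\<lambda>k. frechet_derivative (F k) (at p) v) \<longlonglongrightarrow> frechet_derivative f (at p) v" if "p \<in> U"
    using D that frechet_derivative_at by metis
qed

text \<open>
  What matters is that the constant depends only on \<open>R\<close> and a bound for \<open>f\<close>, not on the point \<open>q\<close>:
  this is what makes difference quotients converge uniformly.  On the line \<open>t \<mapsto> f (q + t v)\<close>,
  defined for \<open>\<bar>t\<bar> \<le> \<rho> = R / \<parallel>v\<parallel>\<close>, the Cauchy inequality on discs of radius \<open>\<rho> / 2\<close> bounds
  the second derivative over the unit disc; Taylor's theorem at \<open>t = 1\<close> does the rest.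
\<close>

lemma holo_fun_on_quadratic_remainder:
  fixes f :: "complex ^ 'n::finite \<Rightarrow> complex"
  assumes hf: "holo_fun_on U f" and sub: "cball q R \<subseteq> U" and R: "0 < R"
    and B: "\<And>x. x \<in> cball q R \<Longrightarrow> norm (f x) \<le> B" and v: "norm v \<le> R / 2"
  shows "norm (f (q + v) - f q - frechet_derivative f (at q) v) \<le> 8 * B / R\<^sup>2 * (norm v)\<^sup>2"
proof (cases "v = 0")
  case True
  have "frechet_derivative f (at q) 0 = 0"
    using Cauchy_estimate_several_variables[OF hf sub R B, of 0] by simp
  then show ?thesis using True by simp
next
  case False
  define \<rho> where "\<rho> = R / norm v"
  have \<rho>: "\<rho> > 0" "\<rho> \<ge> 2" using False R v by (auto simp: \<rho>_def field_simps)
  define \<phi> where "\<phi> t = f (q + t *s v)" for t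
  have inc: "q + t *s v \<in> cball q R" if "norm t \<le> \<rho>" for t
    using that False by (simp add: dist_norm norm_vector_scalar_mult \<rho>_def field_simps)
  have der: "(\<phi> has_field_derivative frechet_derivative f (at (q + t *s v)) v) (at t)"
    if "norm t \<le> \<rho>" for t
    unfolding \<phi>_def using holo_fun_on_line[OF hf, of q t v] inc[OF that] sub by blast
  have hol: "\<phi> holomorphic_on ball 0 \<rho>"
    unfolding holomorphic_on_open[OF open_ball] using der by (meson less_imp_le mem_ball_0)
  have cont: "continuous_on (cball 0 \<rho>) \<phi>"
    using der by (meson DERIV_isCont continuous_at_imp_continuous_on mem_cball_0)
  \<comment> \<open>A disc of radius \<open>\<rho> / 2\<close> around a point of the unit disc lies in the disc of radius \<open>\<rho>\<close>
    because \<open>\<rho> \<ge> 2\<close>, which is the assumption \<open>\<parallel>v\<parallel> \<le> R / 2\<close>.\<close>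
  have d2: "norm ((deriv ^^ 2) \<phi> t) \<le> fact 2 * B / (\<rho>/2)^2" if t: "norm t \<le> 1" for t
  proof (rule Cauchy_inequality)
    have b: "norm x \<le> \<rho>" if "dist t x \<le> \<rho>/2" for x
      using that t \<rho> norm_triangle_ineq4[of t "t - x"] by (simp add: dist_norm)
    have "ball t (\<rho>/2) \<subseteq> ball 0 \<rho>"
      using t \<rho> by (simp add: subset_iff dist_norm)
        (smt (verit) norm_minus_commute norm_triangle_ineq2)
    then show "\<phi> holomorphic_on ball t (\<rho>/2)" using hol holomorphic_on_subset by blast
    show "continuous_on (cball t (\<rho>/2)) \<phi>"
      using cont by (rule continuous_on_subset) (use b in auto)
    show "norm (\<phi> x) \<le> B" if "norm (t - x) = \<rho>/2" for x
      unfolding \<phi>_def using B[OF inc] b that by (simp add: dist_norm)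
  qed (use \<rho> in auto)
  have "norm ((deriv ^^ 0) \<phi> 1 - (\<Sum>i\<le>1. (deriv ^^ i) \<phi> 0 * (1 - 0) ^ i / fact i))
        \<le> (fact 2 * B / (\<rho>/2)^2) * norm (1 - 0 :: complex) ^ Suc 1 / fact 1"
  proof (rule complex_Taylor)
    show "convex (cball 0 1 :: complex set)" by simp
    show "((deriv ^^ i) \<phi> has_field_derivative (deriv ^^ Suc i) \<phi> x) (at x within cball 0 1)"
      if "x \<in> cball 0 1" for i x
    proof -
      have "(deriv ^^ i) \<phi> holomorphic_on ball 0 \<rho>"
        using hol by (rule holomorphic_higher_deriv) simp
      moreover have "x \<in> ball 0 \<rho>" using that \<rho> by simp
      ultimately have "((deriv ^^ i) \<phi> has_field_derivative (deriv ^^ Suc i) \<phi> x) (at x)"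
        using holomorphic_derivI[OF _ open_ball] by simp
      then show ?thesis by (rule has_field_derivative_at_within)
    qed
    show "norm ((deriv ^^ Suc 1) \<phi> x) \<le> fact 2 * B / (\<rho>/2)^2" if "x \<in> cball 0 1" for x
      using d2[of x] that by (simp add: numeral_2_eq_2)
  qed auto
  moreover have "(deriv ^^ 1) \<phi> 0 = frechet_derivative f (at q) v"
    using DERIV_imp_deriv[OF der[of 0]] \<rho> by simp
  ultimately have "norm (f (q + v) - f q - frechet_derivative f (at q) v) \<le> 2 * B / (\<rho>/2)^2"
    by (simp add: \<phi>_def algebra_simps)
  also have "2 * B / (\<rho>/2)^2 = 8 * B / R\<^sup>2 * (norm v)\<^sup>2"
    using False R by (simp add: \<rho>_def power2_eq_square field_simps)
  finally show ?thesis .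
qed

text \<open>
  Complex differentiability of \<open>f\<close> says nothing directly about a second derivative.  Both claims
  come from the difference quotients \<open>(f (q + h v) - f q) / h\<close>.  They are holomorphic in \<open>q\<close>,
  and by the quadratic remainder they converge uniformly to the derivative of \<open>f\<close> along \<open>v\<close>
  as \<open>h \<rightarrow> 0\<close>, so this derivative is holomorphic.  Moreover their derivatives in direction \<open>w\<close>
  converge to the second derivative in directions \<open>v\<close>, \<open>w\<close>.  But these derivatives are themselves
  difference quotients along \<open>v\<close> of the derivative of \<open>f\<close> along \<open>w\<close>, hence the symmetry.
\<close>

lemma holo_fun_on_frechet_derivative:
  fixes f :: "complex ^ 'n::finite \<Rightarrow> complex"
  assumes U: "open U" and hf: "holo_fun_on U f"
  shows holo_fun_on_directional_derivative: "holo_fun_on U (\<lambda>q. frechet_derivative f (at q) v)"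
    and frechet_derivative_commute: "p \<in> U \<Longrightarrow>
      frechet_derivative (\<lambda>q. frechet_derivative f (at q) v) (at p) w =
      frechet_derivative (\<lambda>q. frechet_derivative f (at q) w) (at p) v"
proof -
  have *: "\<exists>W. open W \<and> p \<in> W \<and> W \<subseteq> U \<and>
      holo_fun_on W (\<lambda>q. frechet_derivative f (at q) v) \<and>
      (\<exists>h. h \<longlonglongrightarrow> 0 \<and> (\<forall>k. h k \<noteq> 0) \<and>
        (\<forall>w. (\<lambda>k. (frechet_derivative f (at (p + h k *s v)) w - frechet_derivative f (at p) w) / h k)
           \<longlonglongrightarrow> frechet_derivative (\<lambda>q. frechet_derivative f (at q) v) (at p) w))"
    if pU: "p \<in> U" for p v
  proof -
    obtain R where R: "R > 0" "cball p R \<subseteq> U"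
      using U pU by (meson open_contains_cball_eq)
    have "compact (f ` cball p R)"
      using holo_fun_on_continuous[OF hf] R(2) compact_cball
      by (meson compact_continuous_image continuous_on_subset)
    then obtain B where B: "\<And>x. x \<in> cball p R \<Longrightarrow> norm (f x) \<le> B"
      by (meson bounded_iff compact_imp_bounded image_eqI)
    define r where "r = R / 2"
    have r: "r > 0" using R by (simp add: r_def)
    define W where "W = ball p r"
    have cb: "cball q r \<subseteq> cball p R" if "q \<in> W" for q
      using that unfolding W_def
      by (intro cball_subset_cball_iff[THEN iffD2] disjI1) (simp add: r_def dist_commute)
    have W: "open W" "p \<in> W" "W \<subseteq> U"
      using r R cb[THEN subsetD] by (auto simp: W_def r_def subset_iff)
    \<comment> \<open>The steps \<open>h k v\<close> must have length at most \<open>r / 2\<close>, both to remain in the large ball and to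
      be admissible for the remainder estimate of radius \<open>r\<close>; the summand \<open>1\<close> covers \<open>v = 0\<close>.\<close>
    define s where "s = r / 2 / (norm v + 1)"
    have s: "s > 0" using r norm_ge_zero[of v] by (simp add: s_def add_nonneg_pos)
    have "norm v + 1 \<noteq> 0" using norm_ge_zero[of v] by linarith
    then have "s * (norm v + 1) = r / 2" by (metis nonzero_eq_divide_eq s_def)
    then have sv: "s * norm v \<le> r / 2" using s by (simp add: algebra_simps)
    define h :: "nat \<Rightarrow> complex" where "h k = of_real (s * inverse (real (Suc k)))" for k
    have h0: "h k \<noteq> 0" for k using s by (simp add: h_def del: of_nat_Suc)
    have hlim: "h \<longlonglongrightarrow> 0"
      unfolding h_def by (rule tendsto_of_real[where a = 0, simplified])
        (use tendsto_mult_left[OF LIMSEQ_inverse_real_of_nat, of s] in simp)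
    have nh: "norm (h k) \<le> s" for k
      unfolding h_def norm_of_real using s
      by (simp add: abs_mult mult_le_cancel_left2 inverse_le_1_iff del: of_nat_Suc)
    have small: "norm (h k *s v) \<le> r / 2" for k
      unfolding norm_vector_scalar_mult
      by (rule order_trans[OF mult_right_mono[OF nh] sv]) simp
    have shift: "q + h k *s v \<in> U" if "q \<in> W" for q k
      using cb[OF that] small[of k] r R(2) by (force simp: dist_norm)
    define F where "F k q = (f (q + h k *s v) - f q) / h k" for k q
    define D where "D k q w = (frechet_derivative f (at (q + h k *s v)) w
        - frechet_derivative f (at q) w) / h k" for k q w
    have derF: "(F k has_derivative D k q) (at q)" if "q \<in> W" for k q
    proof -
      have "((\<lambda>q. q + h k *s v) has_derivative (\<lambda>w. w)) (at q)"
        by (auto intro!: derivative_eq_intros)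
      from has_derivative_compose[OF this holo_fun_on_has_derivative[OF hf shift[OF that]]]
      show ?thesis
        unfolding F_def D_def divide_inverse
        using holo_fun_on_has_derivative[OF hf] that W(3)
        by (intro has_derivative_mult_left has_derivative_diff) auto
    qed
    have hF: "holo_fun_on W (F k)" for k
    proof (rule holo_fun_onI[OF derF])
      show "D k q (c *s w) = c * D k q w" if "q \<in> W" for q c w
        using frechet_derivative_scale[OF hf shift[OF that]] frechet_derivative_scale[OF hf, of q] that W(3)
        by (auto simp: D_def algebra_simps diff_divide_distrib)
    qed
    have lim: "uniform_limit W F (\<lambda>q. frechet_derivative f (at q) v) sequentially"
    proof (rule uniform_limitI)
      fix e :: real assume e: "e > 0"
      define C where "C = 8 * B / r\<^sup>2 * (norm v)\<^sup>2"
      have est: "dist (F k q) (frechet_derivative f (at q) v) \<le> C * norm (h k)" if "q \<in> W" for k q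
      proof -
        have "norm (f (q + h k *s v) - f q - frechet_derivative f (at q) (h k *s v))
          \<le> 8 * B / r\<^sup>2 * (norm (h k *s v))\<^sup>2"
          using cb[OF that] R(2)
          by (intro holo_fun_on_quadratic_remainder[OF hf _ r _ small]) (auto intro: B)
        also have "\<dots> = C * norm (h k) * norm (h k)"
          by (simp add: C_def norm_vector_scalar_mult power2_eq_square)
        also have "f (q + h k *s v) - f q - frechet_derivative f (at q) (h k *s v)
            = (F k q - frechet_derivative f (at q) v) * h k"
          using h0[of k] that W(3) by (simp add: F_def frechet_derivative_scale[OF hf] subset_iff field_simps)
        finally show ?thesis
          using h0[of k] by (simp add: norm_mult dist_norm)
      qed
      have "(\<lambda>k. C * norm (h k)) \<longlonglongrightarrow> 0"
        using tendsto_mult_right_zero[OF tendsto_norm_zero[OF hlim]] .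
      then have "\<forall>\<^sub>F k in sequentially. C * norm (h k) < e"
        using e by (rule order_tendstoD)
      then show "\<forall>\<^sub>F k in sequentially. \<forall>q\<in>W. dist (F k q) (frechet_derivative f (at q) v) < e"
        by eventually_elim (use est le_less_trans in blast)
    qed
    have "(\<lambda>k. D k p w) \<longlonglongrightarrow> frechet_derivative (\<lambda>q. frechet_derivative f (at q) v) (at p) w" for w
      using holo_fun_on_uniform_limit(2)[OF W(1) hF lim W(2), of w]
        frechet_derivative_at[OF derF[OF W(2)]] by simp
    then show ?thesis
      using W holo_fun_on_uniform_limit(1)[OF W(1) hF lim] hlim h0 unfolding D_def by blast
  qed
  have hol: "holo_fun_on U (\<lambda>q. frechet_derivative f (at q) v)" for v
    unfolding holo_fun_on_def
  proof
    fix p assume "p \<in> U"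
    from *[OF this, of v] show "\<exists>D. ((\<lambda>q. frechet_derivative f (at q) v) has_derivative D) (at p) \<and>
        Vector_Spaces.linear (*s) (*) D"
      unfolding holo_fun_on_def by blast
  qed
  then show "holo_fun_on U (\<lambda>q. frechet_derivative f (at q) v)" .
  assume p: "p \<in> U"
  obtain h where h: "h \<longlonglongrightarrow> 0" "\<And>k. h k \<noteq> (0 :: complex)"
    "(\<lambda>k. (frechet_derivative f (at (p + h k *s v)) w - frechet_derivative f (at p) w) / h k)
       \<longlonglongrightarrow> frechet_derivative (\<lambda>q. frechet_derivative f (at q) v) (at p) w"
    using *[OF p, of v] by blast
  have "((\<lambda>t. frechet_derivative f (at (p + t *s v)) w) has_field_derivative
     frechet_derivative (\<lambda>q. frechet_derivative f (at q) w) (at p) v) (at 0)"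
    using holo_fun_on_line[OF hol, of p 0 v w] p by simp
  then have "((\<lambda>t. (frechet_derivative f (at (p + t *s v)) w - frechet_derivative f (at p) w) / t)
     \<longlongrightarrow> frechet_derivative (\<lambda>q. frechet_derivative f (at q) w) (at p) v) (at 0)"
    by (simp add: has_field_derivative_iff)
  moreover have "filterlim h (at 0) sequentially"
    using h by (simp add: filterlim_at)
  ultimately have "(\<lambda>k. (frechet_derivative f (at (p + h k *s v)) w - frechet_derivative f (at p) w) / h k)
       \<longlonglongrightarrow> frechet_derivative (\<lambda>q. frechet_derivative f (at q) w) (at p) v"
    by (rule filterlim_compose)
  with h(3) show "frechet_derivative (\<lambda>q. frechet_derivative f (at q) v) (at p) w =
      frechet_derivative (\<lambda>q. frechet_derivative f (at q) w) (at p) v"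
    by (rule LIMSEQ_unique)
qed

section \<open>Derivatives along vector fields\<close>

lemma holo_fun_on_const: "holo_fun_on U (\<lambda>p :: complex ^ 'n::finite. c)"
  by (rule holo_fun_onI[OF has_derivative_const]) simp

lemma holo_fun_on_add:
  fixes f :: "complex ^ 'n::finite \<Rightarrow> complex"
  assumes "holo_fun_on U f" "holo_fun_on U g"
  shows "holo_fun_on U (\<lambda>p. f p + g p)"
  by (rule holo_fun_onI[OF has_derivative_add[OF assms[THEN holo_fun_on_has_derivative]]])
     (simp_all add: frechet_derivative_scale[OF assms(1)] frechet_derivative_scale[OF assms(2)]
       algebra_simps)

lemma holo_fun_on_mult:
  fixes f :: "complex ^ 'n::finite \<Rightarrow> complex"
  assumes "holo_fun_on U f" "holo_fun_on U g"
  shows "holo_fun_on U (\<lambda>p. f p * g p)"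
  by (rule holo_fun_onI[OF has_derivative_mult[OF assms[THEN holo_fun_on_has_derivative]]])
     (simp_all add: frechet_derivative_scale[OF assms(1)] frechet_derivative_scale[OF assms(2)]
       algebra_simps)

lemma holo_fun_on_sum:
  fixes f :: "'i \<Rightarrow> complex ^ 'n::finite \<Rightarrow> complex"
  assumes "\<And>i. i \<in> I \<Longrightarrow> holo_fun_on U (f i)"
  shows "holo_fun_on U (\<lambda>p. \<Sum>i\<in>I. f i p)"
  using assms
  by (induction I rule: infinite_finite_induct) (simp_all add: holo_fun_on_const holo_fun_on_add)

lemma has_derivative_component_compose:
  fixes p :: "complex ^ 'n::finite"
  assumes "(\<phi> has_field_derivative d) (at (p $ i))"
  shows "((\<lambda>q. \<phi> (q $ i)) has_derivative (\<lambda>v. d * v $ i)) (at p)"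
  using has_derivative_compose[OF bounded_linear_imp_has_derivative[OF bounded_linear_vec_nth]
      assms[unfolded has_field_derivative_def]] .

lemma holo_fun_on_component_compose:
  assumes "\<And>p. p \<in> U \<Longrightarrow> \<exists>d. (\<phi> has_field_derivative d) (at (p $ i :: complex))"
  shows "holo_fun_on U (\<lambda>p :: complex ^ 'n::finite. \<phi> (p $ i))"
proof -
  obtain d where "\<And>p. p \<in> U \<Longrightarrow> (\<phi> has_field_derivative d p) (at (p $ i))"
    using assms by metis
  then show ?thesis
    by (intro holo_fun_onI[of U _ "\<lambda>p v. d p * v $ i"] has_derivative_component_compose) auto
qed

lemma holo_fun_on_component: "holo_fun_on U (\<lambda>p :: complex ^ 'n::finite. p $ i)"
  by (rule holo_fun_on_component_compose[of U "\<lambda>t. t"]) (blast intro: DERIV_ident)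

lemma holo_fun_on_divide_component:
  fixes f :: "complex ^ 'n::finite \<Rightarrow> complex"
  assumes "holo_fun_on U f" "\<And>p. p \<in> U \<Longrightarrow> p $ i \<noteq> 0"
  shows "holo_fun_on U (\<lambda>p. f p / p $ i)"
  unfolding divide_inverse
  by (intro holo_fun_on_mult assms holo_fun_on_component_compose[of U inverse])
     (use assms(2) DERIV_inverse in blast)

lemma vderiv_eqI: "(f has_derivative D) (at p) \<Longrightarrow> vderiv X f p = D (X p)"
  unfolding vderiv_def by (metis frechet_derivative_at)

lemma vderiv_const: "vderiv X (\<lambda>q. c) p = 0"
  by (rule vderiv_eqI[OF has_derivative_const])

lemma vderiv_add:
  assumes "holo_fun_on U f" "holo_fun_on U g" "p \<in> U"
  shows "vderiv X (\<lambda>q. f q + g q) p = vderiv X f p + vderiv X g p"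
  unfolding vderiv_eqI[OF has_derivative_add[OF assms(1,2)[THEN holo_fun_on_has_derivative, OF assms(3)]]]
  by (simp add: vderiv_def)

lemma vderiv_mult:
  assumes "holo_fun_on U f" "holo_fun_on U g" "p \<in> U"
  shows "vderiv X (\<lambda>q. f q * g q) p = vderiv X f p * g p + f p * vderiv X g p"
  unfolding vderiv_eqI[OF has_derivative_mult[OF assms(1,2)[THEN holo_fun_on_has_derivative, OF assms(3)]]]
  by (simp add: vderiv_def)

lemma vderiv_sum:
  assumes "\<And>i. i \<in> I \<Longrightarrow> holo_fun_on U (f i)" "p \<in> U"
  shows "vderiv X (\<lambda>q. \<Sum>i\<in>I. f i q) p = (\<Sum>i\<in>I. vderiv X (f i) p)"
proof -
  have "((\<lambda>q. \<Sum>i\<in>I. f i q) has_derivative (\<lambda>v. \<Sum>i\<in>I. frechet_derivative (f i) (at p) v)) (at p)"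
    by (intro has_derivative_sum holo_fun_on_has_derivative[OF assms])
  from vderiv_eqI[OF this, of X] show ?thesis by (simp only: vderiv_def)
qed

lemma vderiv_component_compose:
  "(\<phi> has_field_derivative d) (at (p $ i)) \<Longrightarrow> vderiv X (\<lambda>q. \<phi> (q $ i)) p = d * X p $ i"
  by (rule vderiv_eqI[OF has_derivative_component_compose])

lemma vderiv_component: "vderiv X (\<lambda>q. q $ i) p = X p $ i"
  using vderiv_component_compose[OF DERIV_ident] by simp

lemma vderiv_divide_component:
  assumes "holo_fun_on U f" "\<And>q. q \<in> U \<Longrightarrow> q $ i \<noteq> 0" "p \<in> U"
  shows "vderiv X (\<lambda>q. f q / q $ i) p = vderiv X f p / p $ i - f p * X p $ i / (p $ i)\<^sup>2"
proof -
  have d: "(inverse has_field_derivative - inverse ((q $ i)\<^sup>2)) (at (q $ i))" if "q \<in> U" for q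
    using DERIV_inverse[of "q $ i"] assms(2)[OF that]
    by (simp add: power2_eq_square numeral_2_eq_2)
  have "holo_fun_on U (\<lambda>q. inverse (q $ i))"
    by (rule holo_fun_on_component_compose) (use d in blast)
  then show ?thesis
    unfolding divide_inverse
    by (simp add: vderiv_mult[OF assms(1) _ assms(3)] vderiv_component_compose[OF d[OF assms(3)]]
        power2_eq_square algebra_simps)
qed

lemma vderiv_cong:
  assumes "open U" "p \<in> U" "\<And>q. q \<in> U \<Longrightarrow> f q = g q" "X p = Y p"
  shows "vderiv X f p = vderiv Y g p"
proof -
  have "(f has_derivative D) (at p) \<longleftrightarrow> (g has_derivative D) (at p)" for D
    using has_derivative_transform_within_open[OF _ assms(1,2), of f D UNIV g]
      has_derivative_transform_within_open[OF _ assms(1,2), of g D UNIV f] assms(3) by auto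
  then have "frechet_derivative f (at p) = frechet_derivative g (at p)"
    unfolding frechet_derivative_def by simp
  then show ?thesis using assms(4) by (simp add: vderiv_def)
qed

lemma frechet_derivative_coordinates:
  fixes f :: "complex ^ 'n::finite \<Rightarrow> complex"
  assumes "holo_fun_on U f" "p \<in> U"
  shows "frechet_derivative f (at p) v = (\<Sum>i\<in>UNIV. v $ i * frechet_derivative f (at p) (axis i 1))"
proof -
  have "frechet_derivative f (at p) v = frechet_derivative f (at p) (\<Sum>i\<in>UNIV. v $ i *s axis i 1)"
    by (simp add: basis_expansion)
  also have "\<dots> = (\<Sum>i\<in>UNIV. frechet_derivative f (at p) (v $ i *s axis i 1))"
    using has_derivative_linear[OF holo_fun_on_has_derivative[OF assms]] by (rule linear_sum)
  finally show ?thesis by (simp add: frechet_derivative_scale[OF assms])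
qed

lemma holo_fun_on_vderiv:
  assumes "open U" "holo_vfield_on U X" "holo_fun_on U f"
  shows "holo_fun_on U (vderiv X f)"
proof -
  have "holo_fun_on U (\<lambda>p. \<Sum>i\<in>UNIV. X p $ i * frechet_derivative f (at p) (axis i 1))"
    using assms by (intro holo_fun_on_sum holo_fun_on_mult holo_fun_on_directional_derivative)
      (auto simp: holo_vfield_on_def)
  moreover have "vderiv X f p = (\<Sum>i\<in>UNIV. X p $ i * frechet_derivative f (at p) (axis i 1))"
    if "p \<in> U" for p
    unfolding vderiv_def by (rule frechet_derivative_coordinates[OF assms(3) that])
  ultimately show ?thesis
    using assms(1) unfolding holo_fun_on_def
    by (metis (no_types, lifting) has_derivative_transform_within_open)
qed

text \<open>
  In coordinates \<open>Y f = \<Sum>\<^sub>i Y\<^sub>i \<partial>\<^sub>i f\<close>.  Differentiating the product gives a Hessian term, which is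
  symmetric in \<open>X\<close> and \<open>Y\<close>, and a term that only involves the derivative of \<open>Y\<close>.
\<close>

lemma vderiv_vderiv:
  assumes U: "open U" and X: "holo_vfield_on U X" and Y: "holo_vfield_on U Y"
    and f: "holo_fun_on U f" and p: "p \<in> U"
  shows "vderiv X (vderiv Y f) p =
    frechet_derivative (\<lambda>q. frechet_derivative f (at q) (X p)) (at p) (Y p) +
    (\<Sum>i\<in>UNIV. vderiv X (\<lambda>q. Y q $ i) p * frechet_derivative f (at p) (axis i 1))"
proof -
  define d where "d v q = frechet_derivative f (at q) v" for v q
  have d: "holo_fun_on U (d v)" for v
    unfolding d_def by (rule holo_fun_on_directional_derivative[OF U f])
  have Yi: "holo_fun_on U (\<lambda>q. Y q $ i)" for i using Y by (simp add: holo_vfield_on_def)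
  have "vderiv X (vderiv Y f) p = vderiv X (\<lambda>q. \<Sum>i\<in>UNIV. Y q $ i * d (axis i 1) q) p"
    by (rule vderiv_cong[OF U p]) (simp_all add: vderiv_def d_def frechet_derivative_coordinates[OF f])
  also have "\<dots> = (\<Sum>i\<in>UNIV. vderiv X (\<lambda>q. Y q $ i) p * d (axis i 1) p +
      Y p $ i * vderiv X (d (axis i 1)) p)"
    by (simp add: vderiv_sum[OF holo_fun_on_mult[OF Yi d] p] vderiv_mult[OF Yi d p])
  finally have eq: "vderiv X (vderiv Y f) p = (\<Sum>i\<in>UNIV. vderiv X (\<lambda>q. Y q $ i) p * d (axis i 1) p +
      Y p $ i * vderiv X (d (axis i 1)) p)" .
  have "vderiv X (d (axis i 1)) p = frechet_derivative (d (X p)) (at p) (axis i 1)" for i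
    unfolding vderiv_def d_def by (rule frechet_derivative_commute[OF U f p])
  with eq show ?thesis
    by (simp add: sum.distrib frechet_derivative_coordinates[OF d p, of "X p" "Y p", unfolded d_def] d_def[abs_def])
qed

text \<open>
  The Hessian terms cancel, and the first order terms assemble to the bracket.
\<close>

lemma vderiv_commutator:
  assumes U: "open U" and X: "holo_vfield_on U X" and Y: "holo_vfield_on U Y"
    and f: "holo_fun_on U f" and p: "p \<in> U"
  shows "vderiv X (vderiv Y f) p - vderiv Y (vderiv X f) p = vderiv (bracket X Y) f p"
proof -
  have "vderiv (bracket X Y) f p = (\<Sum>i\<in>UNIV. bracket X Y p $ i * frechet_derivative f (at p) (axis i 1))"
    unfolding vderiv_def by (rule frechet_derivative_coordinates[OF f p])
  then show ?thesis
    unfolding vderiv_vderiv[OF U X Y f p] vderiv_vderiv[OF U Y X f p]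
      frechet_derivative_commute[OF U f p, of "X p" "Y p"]
    by (simp add: bracket_def left_diff_distrib sum_subtractf)
qed

section \<open>The structure on the coordinate torus\<close>

lemma complement_coordinate_arrangement:
  "UNIV - \<Union> coordinate_arrangement = {z :: complex ^ 'n::finite. \<forall>i. z $ i \<noteq> 0}"
  by (auto simp: coordinate_arrangement_def)

lemma open_complement_coordinate_arrangement:
  "open {z :: complex ^ 'n::finite. \<forall>i. z $ i \<noteq> 0}"
proof -
  have "{z :: complex ^ 'n. \<forall>i. z $ i \<noteq> 0} = (\<Inter>i. {z. z $ i \<noteq> 0})" by auto
  also have "open \<dots>"
    by (intro open_INT finite ballI open_Collect_neq continuous_intros)
  finally show ?thesis .
qed

definition dot_form :: "'n::finite form" where
  "dot_form p v w = (\<Sum>i\<in>UNIV. v $ i * w $ i)"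

definition coordinate_connection :: "'n::finite connection" where
  "coordinate_connection X Y p = (\<chi> i. vderiv X (\<lambda>q. Y q $ i) p)"

text \<open>
  In terms of the fields \<open>e\<^sub>i = z\<^sub>i \<partial>\<^sub>i\<close> this is \<open>e\<^sub>i \<cdot> e\<^sub>j = \<delta>\<^sub>i\<^sub>j e\<^sub>i\<close>: the logarithms
  of the coordinates are canonical coordinates of a semisimple product.
\<close>

definition log_product :: "'n::finite product" where
  "log_product p v w = (\<chi> i. v $ i * w $ i / p $ i)"

lemma holo_vfield_onD: "holo_vfield_on U X \<Longrightarrow> holo_fun_on U (\<lambda>p. X p $ i)"
  by (simp add: holo_vfield_on_def)

lemmas holo_intros = holo_fun_on_const holo_fun_on_add holo_fun_on_diff holo_fun_on_mult
  holo_fun_on_sum holo_fun_on_component holo_fun_on_divide_component holo_fun_on_vderiv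
  holo_vfield_onD

lemma holo_metric_dot_form: "holo_metric_on M (dot_form :: 'n::finite form)"
proof -
  have "v = 0" if "\<And>w. dot_form p v w = 0" for p v :: "complex ^ 'n"
  proof -
    have "v $ i = 0" for i
      using that[of "axis i 1"] by (simp add: dot_form_def axis_def if_distrib cong: if_cong)
    then show ?thesis by (simp add: vec_eq_iff)
  qed
  then show ?thesis
    unfolding holo_metric_on_def
    by (auto simp: dot_form_def complex_linear_iff holo_fun_on_const algebra_simps sum.distrib
        sum_distrib_left)
qed

lemma holo_connection_coordinate: "holo_connection_on M (coordinate_connection :: 'n::finite connection)"
  unfolding holo_connection_on_def
proof (intro allI impI conjI ballI; (elim conjE)?)
  fix U :: "(complex ^ 'n) set" and X Y :: "'n vfield"
  assume "open U" "holo_vfield_on U X" "holo_vfield_on U Y"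
  then show "holo_vfield_on U (coordinate_connection X Y)"
    by (simp add: holo_vfield_on_def coordinate_connection_def holo_fun_on_vderiv)
next
  fix U :: "(complex ^ 'n) set" and X X' Y Y' :: "'n vfield" and p
  assume "open U" "p \<in> U" "\<forall>p\<in>U. X' p = X p \<and> Y' p = Y p"
  then show "coordinate_connection X' Y' p = coordinate_connection X Y p"
    by (auto simp: coordinate_connection_def vec_eq_iff intro!: vderiv_cong)
next
  fix U :: "(complex ^ 'n) set" and X X' Y :: "'n vfield" and p
  assume Y: "holo_vfield_on U Y" and p: "p \<in> U"
  show "coordinate_connection (\<lambda>q. X q + X' q) Y p = coordinate_connection X Y p + coordinate_connection X' Y p"
    using linear_add[OF has_derivative_linear[OF holo_fun_on_has_derivative[OF holo_vfield_onD[OF Y] p]]]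
    by (simp add: coordinate_connection_def vec_eq_iff vderiv_def)
next
  fix U :: "(complex ^ 'n) set" and X Y :: "'n vfield" and f p
  assume "holo_vfield_on U Y" "p \<in> U"
  then show "coordinate_connection (\<lambda>q. f q *s X q) Y p = f p *s coordinate_connection X Y p"
    by (simp add: coordinate_connection_def vec_eq_iff vderiv_def
        frechet_derivative_scale[OF holo_vfield_onD])
next
  fix U :: "(complex ^ 'n) set" and X Y Y' :: "'n vfield" and p
  assume "holo_vfield_on U Y" "holo_vfield_on U Y'" "p \<in> U"
  then show "coordinate_connection X (\<lambda>q. Y q + Y' q) p = coordinate_connection X Y p + coordinate_connection X Y' p"
    by (simp add: coordinate_connection_def vec_eq_iff vderiv_add[OF holo_vfield_onD holo_vfield_onD])
next
  fix U :: "(complex ^ 'n) set" and X Y :: "'n vfield" and f p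
  assume "holo_fun_on U f" "holo_vfield_on U Y" "p \<in> U"
  then show "coordinate_connection X (\<lambda>q. f q *s Y q) p =
      vderiv X f p *s Y p + f p *s coordinate_connection X Y p"
    by (simp add: coordinate_connection_def vec_eq_iff vderiv_mult[OF _ holo_vfield_onD])
qed

lemma levi_civita_coordinate:
  "levi_civita_on M dot_form (coordinate_connection :: 'n::finite connection)"
  unfolding levi_civita_on_def
proof (intro allI impI conjI ballI holo_connection_coordinate; elim conjE)
  fix U :: "(complex ^ 'n) set" and X Y :: "'n vfield" and p
  show "coordinate_connection X Y p - coordinate_connection Y X p = bracket X Y p"
    by (simp add: coordinate_connection_def bracket_def vec_eq_iff)
next
  fix U :: "(complex ^ 'n) set" and X Y Z :: "'n vfield" and p
  assume YZ: "holo_vfield_on U Y" "holo_vfield_on U Z" and p: "p \<in> U"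
  note [simp] = vderiv_sum[OF holo_fun_on_mult[OF YZ[THEN holo_vfield_onD]] p]
    vderiv_mult[OF YZ[THEN holo_vfield_onD] p]
  show "vderiv X (app_form dot_form Y Z) p =
      app_form dot_form (coordinate_connection X Y) Z p + app_form dot_form Y (coordinate_connection X Z) p"
    by (simp add: app_form_def dot_form_def coordinate_connection_def sum.distrib)
qed

text \<open>
  The deformed connection is diagonal: on the \<open>i\<close>-th component it is the scalar operator
  \<open>X + l X\<^sub>i / z\<^sub>i\<close>, that is, the trivial connection twisted by the closed one-form
  \<open>l dz\<^sub>i / z\<^sub>i\<close>.  In the curvature the second derivatives combine to the bracket term, and the
  derivative of \<open>1 / z\<^sub>i\<close> contributes \<open>X\<^sub>i Y\<^sub>i / z\<^sub>i\<^sup>2\<close>, symmetric in \<open>X\<close> and \<open>Y\<close>.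
\<close>

lemma flat_deformed_coordinate_connection:
  "flat_connection_on {z. \<forall>i. z $ i \<noteq> 0}
     (deformed_connection coordinate_connection log_product l :: 'n::finite connection)"
  unfolding flat_connection_on_def
proof (intro allI impI ballI; elim conjE)
  fix U :: "(complex ^ 'n) set" and X Y Z :: "'n vfield" and p
  assume U: "open U" "U \<subseteq> {z. \<forall>i. z $ i \<noteq> 0}"
    and X: "holo_vfield_on U X" and Y: "holo_vfield_on U Y" and Z: "holo_vfield_on U Z"
    and p: "p \<in> U"
  have nz: "q $ i \<noteq> 0" if "q \<in> U" for q i using U that by blast
  define D :: "'n connection" where "D = deformed_connection coordinate_connection log_product l"
  have D: "D V W q $ i = vderiv V (\<lambda>q. W q $ i) q + l * (V q $ i * W q $ i / q $ i)" for V W q i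
    by (simp add: D_def deformed_connection_def coordinate_connection_def app_product_def log_product_def)
  have DD: "D V (D W Z) p $ i = vderiv V (vderiv W (\<lambda>q. Z q $ i)) p
      + l * ((vderiv V (\<lambda>q. W q $ i) p * Z p $ i + W p $ i * vderiv V (\<lambda>q. Z q $ i) p) / p $ i
              - W p $ i * Z p $ i * V p $ i / (p $ i)\<^sup>2)
      + l * (V p $ i * (vderiv W (\<lambda>q. Z q $ i) p + l * (W p $ i * Z p $ i / p $ i)) / p $ i)"
    if V: "holo_vfield_on U V" and W: "holo_vfield_on U W" for V W i
  proof -
    have hol: "holo_fun_on U (vderiv W (\<lambda>q. Z q $ i))" "holo_fun_on U (\<lambda>q. W q $ i * Z q $ i)"
      "holo_fun_on U (\<lambda>q. W q $ i * Z q $ i / q $ i)"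
      using U(1) W Z nz by (auto intro!: holo_intros)
    have "vderiv V (\<lambda>q. D W Z q $ i) p = vderiv V (vderiv W (\<lambda>q. Z q $ i)) p
      + l * ((vderiv V (\<lambda>q. W q $ i) p * Z p $ i + W p $ i * vderiv V (\<lambda>q. Z q $ i) p) / p $ i
              - W p $ i * Z p $ i * V p $ i / (p $ i)\<^sup>2)"
      by (simp only: D vderiv_add[OF hol(1) holo_fun_on_mult[OF holo_fun_on_const hol(3)] p]
          vderiv_mult[OF holo_fun_on_const hol(3) p] vderiv_const
          vderiv_divide_component[OF hol(2) nz p]
          vderiv_mult[OF holo_vfield_onD[OF W] holo_vfield_onD[OF Z] p] mult_zero_left add_0_left)
    then show ?thesis unfolding D[of V] by (simp add: D)
  qed
  have "curvature D X Y Z p $ i = 0" for i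
  proof -
    have br: "bracket X Y p $ i = vderiv X (\<lambda>q. Y q $ i) p - vderiv Y (\<lambda>q. X q $ i) p"
      by (simp add: bracket_def)
    have "curvature D X Y Z p $ i = D X (D Y Z) p $ i - D Y (D X Z) p $ i - D (bracket X Y) Z p $ i"
      by (simp add: curvature_def)
    also have "\<dots> = 0"
      unfolding DD[OF X Y] DD[OF Y X] D[of "bracket X Y"] br
        vderiv_commutator[OF U(1) X Y holo_vfield_onD[OF Z] p, symmetric]
      using nz[OF p, of i] by (simp add: field_simps power2_eq_square)
    finally show ?thesis .
  qed
  then show "curvature (deformed_connection coordinate_connection log_product l) X Y Z p = 0"
    by (simp add: D_def vec_eq_iff)
qed

lemma flat_coordinate_connection:
  "flat_connection_on {z. \<forall>i. z $ i \<noteq> 0} (coordinate_connection :: 'n::finite connection)"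
proof -
  have "deformed_connection coordinate_connection log_product 0 = (coordinate_connection :: 'n connection)"
    by (simp add: deformed_connection_def fun_eq_iff)
  then show ?thesis by (metis flat_deformed_coordinate_connection)
qed

lemma holo_product_log_product:
  "holo_product_on {z. \<forall>i. z $ i \<noteq> 0} (log_product :: 'n::finite product)"
  unfolding holo_product_on_def holo_vfield_on_def
  by (auto simp: log_product_def Vector_Spaces.linear_iff vec.vector_space_axioms vec_eq_iff
      algebra_simps add_divide_distrib intro!: holo_intros)

text \<open>
  The potential and its iterated derivatives along flat fields are all sums of terms
  \<open>\<psi>\<^sub>i (z\<^sub>i) c\<^sub>i\<close> in which the \<open>c\<^sub>i\<close> are products of components of flat fields, so have derivative zero.
  The coefficients are kept as functions because a flat field on a disconnected open set is only
  locally constant.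
\<close>

lemma vderiv_separable:
  fixes c :: "'n::finite \<Rightarrow> complex ^ 'n \<Rightarrow> complex"
  assumes c: "\<And>i. holo_fun_on V (c i)" and flat: "\<And>i. vderiv X (c i) q = 0"
    and \<psi>: "\<And>i z. z \<in> V \<Longrightarrow> (\<psi> i has_field_derivative \<psi>' i (z $ i)) (at (z $ i))"
    and q: "q \<in> V"
  shows "vderiv X (\<lambda>z. \<Sum>i\<in>UNIV. \<psi> i (z $ i) * c i z) q =
    (\<Sum>i\<in>UNIV. \<psi>' i (q $ i) * (X q $ i * c i q))"
proof -
  have h: "holo_fun_on V (\<lambda>z. \<psi> i (z $ i))" for i
    by (rule holo_fun_on_component_compose) (use \<psi> in blast)
  show ?thesis
    by (simp add: vderiv_sum[OF holo_fun_on_mult[OF h c] q] vderiv_mult[OF h c q] flat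
        vderiv_component_compose[OF \<psi>[OF q]] mult.assoc)
qed

lemma vderiv_flat_component:
  assumes "flat_vfield_on V coordinate_connection X" "holo_vfield_on V W" "q \<in> V"
  shows "vderiv W (\<lambda>z. X z $ i) q = 0"
proof -
  have "coordinate_connection W X q $ i = 0"
    using assms unfolding flat_vfield_on_def by simp
  then show ?thesis by (simp add: coordinate_connection_def)
qed

text \<open>
  The third derivative of \<open>t\<^sup>2 / 2 log t\<close> is \<open>1 / t\<close>, so \<open>\<Phi> = \<Sum>\<^sub>i z\<^sub>i\<^sup>2 / 2 log z\<^sub>i\<close> is a potential
  wherever branches of the logarithms exist.
\<close>

lemma potential_log_product:
  fixes p :: "complex ^ 'n::finite"
  assumes p: "\<And>i. p $ i \<noteq> 0"
  shows "\<exists>U \<Phi>. open U \<and> p \<in> U \<and> U \<subseteq> {z. \<forall>i. z $ i \<noteq> 0} \<and> holo_fun_on U \<Phi> \<and>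
      (\<forall>V X Y Z. open V \<and> V \<subseteq> U \<and> flat_vfield_on V coordinate_connection X \<and>
         flat_vfield_on V coordinate_connection Y \<and> flat_vfield_on V coordinate_connection Z \<longrightarrow>
         (\<forall>q\<in>V. vderiv X (vderiv Y (vderiv Z \<Phi>)) q = app_form dot_form (app_product log_product X Y) Z q))"
proof -
  \<comment> \<open>Dividing by \<open>p\<^sub>i\<close> moves the branch cut away from \<open>p\<close>; it changes \<open>\<Phi>\<close> by a quadratic
    polynomial only.\<close>
  define U where "U = {z :: complex ^ 'n. \<forall>i. 0 < Re (z $ i / p $ i)}"
  define L where "L i t = Ln (t / p $ i)" for i t
  define \<psi>0 where "\<psi>0 i t = t\<^sup>2 / 2 * L i t" for i t
  define \<psi>1 where "\<psi>1 i t = t * L i t + t / 2" for i t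
  define \<psi>2 where "\<psi>2 i t = L i t + 3 / 2" for i t
  define \<Phi> where "\<Phi> z = (\<Sum>i\<in>UNIV. \<psi>0 i (z $ i) * 1)" for z
  have "U = (\<Inter>i. {z. 0 < Re (z $ i / p $ i)})" by (auto simp: U_def)
  also have "open \<dots>"
    using p by (intro open_INT finite ballI open_Collect_less continuous_intros) auto
  finally have U: "open U" .
  have slit: "z $ i / p $ i \<notin> \<real>\<^sub>\<le>\<^sub>0" if "z \<in> U" for z i
    using that by (auto simp: U_def complex_nonpos_Reals_iff not_le)
  have nz: "z $ i \<noteq> 0" if "z \<in> U" for z i
    using slit[OF that, of i] by auto
  have dLn: "(L i has_field_derivative 1 / z $ i) (at (z $ i))" if "z \<in> U" for z i
  proof -
    have "((\<lambda>t. t / p $ i) has_field_derivative 1 / p $ i) (at (z $ i))"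
      by (rule DERIV_cdivide[OF DERIV_ident])
    from DERIV_chain2[OF has_field_derivative_Ln[OF slit[OF that]] this]
    show ?thesis unfolding L_def[abs_def] using p[of i] nz[OF that, of i] by simp
  qed
  have d0: "(\<psi>0 i has_field_derivative \<psi>1 i (z $ i)) (at (z $ i))" if "z \<in> U" for z i
    unfolding \<psi>0_def[abs_def] \<psi>1_def using nz[OF that, of i]
    by (auto intro!: derivative_eq_intros dLn[OF that] simp: field_simps power2_eq_square)
  have d1: "(\<psi>1 i has_field_derivative \<psi>2 i (z $ i)) (at (z $ i))" if "z \<in> U" for z i
    unfolding \<psi>1_def[abs_def] \<psi>2_def using nz[OF that, of i]
    by (auto intro!: derivative_eq_intros dLn[OF that] simp: field_simps)
  have d2: "(\<psi>2 i has_field_derivative 1 / z $ i) (at (z $ i))" if "z \<in> U" for z i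
    unfolding \<psi>2_def[abs_def]
    by (auto intro!: derivative_eq_intros dLn[OF that])
  have \<Phi>: "holo_fun_on U \<Phi>"
    unfolding \<Phi>_def[abs_def]
    by (intro holo_fun_on_sum holo_fun_on_mult holo_fun_on_const holo_fun_on_component_compose)
      (use d0 in blast)
  have third: "vderiv X (vderiv Y (vderiv Z \<Phi>)) q = app_form dot_form (app_product log_product X Y) Z q"
    if V: "open V" "V \<subseteq> U" and fl: "flat_vfield_on V coordinate_connection X"
      "flat_vfield_on V coordinate_connection Y" "flat_vfield_on V coordinate_connection Z"
      and q: "q \<in> V" for V X Y Z q
  proof -
    have hol: "holo_vfield_on V X" "holo_vfield_on V Y" "holo_vfield_on V Z"
      using fl by (auto simp: flat_vfield_on_def)
    have s1: "vderiv Z \<Phi> z = (\<Sum>i\<in>UNIV. \<psi>1 i (z $ i) * Z z $ i)" if "z \<in> V" for z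
      using vderiv_separable[where c = "\<lambda>i z. 1" and \<psi> = \<psi>0 and \<psi>' = \<psi>1 and X = Z and V = V,
          OF holo_fun_on_const vderiv_const d0 that] V(2)
      by (auto simp: \<Phi>_def[abs_def])
    have s2: "vderiv Y (vderiv Z \<Phi>) z = (\<Sum>i\<in>UNIV. \<psi>2 i (z $ i) * (Y z $ i * Z z $ i))" if z: "z \<in> V" for z
    proof -
      have "vderiv Y (vderiv Z \<Phi>) z = vderiv Y (\<lambda>z. \<Sum>i\<in>UNIV. \<psi>1 i (z $ i) * Z z $ i) z"
        by (rule vderiv_cong[OF V(1) z s1 refl])
      also have "\<dots> = (\<Sum>i\<in>UNIV. \<psi>2 i (z $ i) * (Y z $ i * Z z $ i))"
        by (rule vderiv_separable[where c = "\<lambda>i z. Z z $ i", OF holo_vfield_onD[OF hol(3)]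
              vderiv_flat_component[OF fl(3) hol(2) z] d1 z]) (use V(2) in auto)
      finally show ?thesis .
    qed
    have "vderiv X (vderiv Y (vderiv Z \<Phi>)) q =
        vderiv X (\<lambda>z. \<Sum>i\<in>UNIV. \<psi>2 i (z $ i) * (Y z $ i * Z z $ i)) q"
      by (rule vderiv_cong[OF V(1) q s2 refl])
    also have "\<dots> = (\<Sum>i\<in>UNIV. (1 / q $ i) * (X q $ i * (Y q $ i * Z q $ i)))"
    proof (rule vderiv_separable[where c = "\<lambda>i z. Y z $ i * Z z $ i" and \<psi>' = "\<lambda>i t. 1 / t", OF _ _ d2 q])
      show "holo_fun_on V (\<lambda>z. Y z $ i * Z z $ i)" for i
        using hol by (intro holo_intros)
      show "vderiv X (\<lambda>z. Y z $ i * Z z $ i) q = 0" for i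
        by (simp add: vderiv_mult[OF hol(2,3)[THEN holo_vfield_onD] q]
            vderiv_flat_component[OF fl(2) hol(1) q] vderiv_flat_component[OF fl(3) hol(1) q])
    qed (use V(2) in auto)
    finally show ?thesis
      by (simp add: app_form_def app_product_def dot_form_def log_product_def algebra_simps)
  qed
  have pU: "p \<in> U" using p by (simp add: U_def)
  have sub: "U \<subseteq> {z. \<forall>i. z $ i \<noteq> 0}" using nz by blast
  show ?thesis
    by (rule exI[of _ U], rule exI[of _ \<Phi>], intro conjI allI impI ballI U pU sub \<Phi>)
      (elim conjE, rule third)
qed

lemma bracket_radial: "bracket (\<lambda>q. q) X p $ i = vderiv (\<lambda>q. q) (\<lambda>q. X q $ i) p - X p $ i"
  by (simp add: bracket_def vderiv_component)

text \<open>
  Each \<open>\<partial>\<^sub>i\<close> has weight \<open>-1\<close> under the radial field, so a form with constant coefficients has weight 2.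
\<close>

lemma lie_form_radial_dot_form:
  fixes X Y :: "'n::finite vfield"
  assumes XY: "holo_vfield_on U X" "holo_vfield_on U Y" and p: "p \<in> U"
  shows "lie_form (\<lambda>q. q) dot_form X Y p = 2 * app_form dot_form X Y p"
proof -
  note [simp] = vderiv_sum[OF holo_fun_on_mult[OF XY[THEN holo_vfield_onD]] p]
    vderiv_mult[OF XY[THEN holo_vfield_onD] p]
  show ?thesis
    by (simp add: lie_form_def app_form_def dot_form_def bracket_radial algebra_simps sum.distrib
        sum_subtractf)
qed

text \<open>
  The product is the tensor \<open>\<Sum>\<^sub>i z\<^sub>i\<^sup>-\<^sup>1 dz\<^sub>i \<otimes> dz\<^sub>i \<otimes> \<partial>\<^sub>i\<close>, which scaling leaves
  invariant: the weights are \<open>-1 + 1 + 1 - 1 = 0\<close>.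
\<close>

lemma lie_product_radial_log_product:
  fixes X Y :: "'n::finite vfield"
  assumes U: "U \<subseteq> {z. \<forall>i. z $ i \<noteq> 0}"
    and XY: "holo_vfield_on U X" "holo_vfield_on U Y" and p: "p \<in> U"
  shows "lie_product (\<lambda>q. q) log_product X Y p = 0"
proof -
  have nz: "q $ i \<noteq> 0" if "q \<in> U" for q i using U that by blast
  note [simp] = vderiv_divide_component[OF holo_fun_on_mult[OF XY[THEN holo_vfield_onD]] nz p]
    vderiv_mult[OF XY[THEN holo_vfield_onD] p]
  show ?thesis
    using nz[OF p]
    by (simp add: lie_product_def app_product_def log_product_def bracket_radial vec_eq_iff
        field_simps power2_eq_square)
qed

theorem theorem3p3:
  "\<exists>g nabla m E. almost_frobenius_structure
     (UNIV - \<Union> (coordinate_arrangement :: (complex ^ 'n) set set)) g nabla m E"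
proof -
  have "almost_frobenius_structure {z :: complex ^ 'n. \<forall>i. z $ i \<noteq> 0}
      dot_form coordinate_connection log_product (\<lambda>q. q)"
  proof
    show "open {z :: complex ^ 'n. \<forall>i. z $ i \<noteq> 0}"
      by (rule open_complement_coordinate_arrangement)
    show "app_form dot_form (app_product log_product X Y) Z p =
        app_form dot_form X (app_product log_product Y Z) p" for X Y Z :: "'n vfield" and p
      by (simp add: app_form_def app_product_def dot_form_def log_product_def algebra_simps)
    show "log_product p p v = v" if "p \<in> {z. \<forall>i. z $ i \<noteq> 0}" for p v :: "complex ^ 'n"
      using that by (simp add: log_product_def vec_eq_iff)
    show "holo_vfield_on {z :: complex ^ 'n. \<forall>i. z $ i \<noteq> 0} (\<lambda>q. q)"
      by (simp add: holo_vfield_on_def holo_fun_on_component)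
    show "\<exists>c. \<forall>U X Y. open U \<and> U \<subseteq> {z :: complex ^ 'n. \<forall>i. z $ i \<noteq> 0} \<and>
        holo_vfield_on U X \<and> holo_vfield_on U Y \<longrightarrow>
        (\<forall>p\<in>U. lie_product (\<lambda>q. q) log_product X Y p = c *s app_product log_product X Y p)"
      using lie_product_radial_log_product by (intro exI[of _ 0]) auto
  qed (fact holo_metric_dot_form levi_civita_coordinate flat_coordinate_connection
      holo_product_log_product flat_deformed_coordinate_connection |
      rule lie_form_radial_dot_form potential_log_product; simp)+
  then show ?thesis unfolding complement_coordinate_arrangement by blast
qed

end
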